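(* Let $\mathcal{C}\subseteq\mathbb{F}_2^N$ be any linear block code, let $\underline{e}(1),\dots,\underline{e}(T)\in\mathbb{F}_2^N$ be an ordered list of distinct error patterns, and let $\pi$ be a uniformly random coordinate permutation of $\{1,\dots,N\}$. For every $1\le t\le T$, the pre-target codeword-hit probability $f(\mathcal{C},\mathcal{E},t)=\Pr\left(\exists\,t'<t:\ \pi(\underline{e}(t')\oplus\underline{e}(t))\in\mathcal{C}\right)$ admits the representation $$f(\mathcal{C},\mathcal{E},t)=\sum_{j=1}^{t-1}(-1)^{j-1}\sum_{1\le i_1<\cdots<i_j<t}\frac{1}{N!}\,Z(\mathbf{g})\,\mathcal{H}(\mathbf{g}),$$ where, in each term, $\mathbf{g}=\mathcal{F}(\underline{e}(i_1,t),\dots,\underline{e}(i_j,t))$.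
   Context: Setting: $\pi$ is the rank-based permutation of ORB-type GRAND over a memoryless output-symmetric channel with tie-free reliabilities; it is a uniformly distributed random permutation of the $N$ coordinates, acting on vectors of $\mathbb{F}_2^N$ by permuting coordinates. A linear block code is a linear subspace of $\mathbb{F}_2^N$. $\mathcal{E}$ denotes the ordered list of error patterns. EP difference: $\underline{e}(i,j)=\underline{e}(i)\oplus\underline{e}(j)$. Weight relationship: for an ordered tuple $[\underline{u}(1),\dots,\underline{u}(j)]$ of vectors in $\{0,1\}^N$, $\mathcal{F}(\underline{u}(1),\dots,\underline{u}(j))=(g(\underline{b}))_{\underline{b}\in\{0,1\}^j}$ (indices in lexicographic order), where $g(\underline{0})=N$ and $g(\underline{b})=w_{\mathrm H}\left(\bigoplus_{i=1}^{j}b_i\underline{u}(i)\right)$ for $\underline{b}\ne\underline{0}$, with $w_{\mathrm H}$ the Hamming weight. Multiplicity: $Z(\mathbf{g})$ is the number of ordered tuples $[\underline{u}(1),\dots,\underline{u}(j)]\in\mathcal{C}^j$ with $\mathcal{F}(\underline{u}(1),\dots,\underline{u}(j))=\mathbf{g}$. Coordinate-permutation factor: if $\mathbf{g}=\mathcal{F}(\underline{x}(1),\dots,\underline{x}(j))$, put $J(\underline{s})=|\{k\in\{1,\dots,N\}:(x_k(1),\dots,x_k(j))=\underline{s}\}|$ for $\underline{s}\in\{0,1\}^j$ and $\mathcal{H}(\mathbf{g})=\prod_{\underline{s}\in\{0,1\}^j}J(\underline{s})!$ (the numbers $J(\underline{s})$ depend on the tuple only through $\mathbf{g}$; above one may take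 $\underline{x}(k)=\underline{e}(i_k,t)$). *)

theory Defs
  imports "HOL-Probability.Probability" "HOL-Library.Z2"
begin

text \<open>The binary space of block length $N$ is \<open>bit ^ 'n\<close> with \<open>N = CARD('n)\<close>: the
  coordinates are labelled by the elements of \<open>'n\<close>, and vector addition is the bitwise
  exclusive or. Ordered tuples are lists.\<close>

definition hamming_weight :: "bit ^ 'n \<Rightarrow> nat" where
  "hamming_weight v = card {k. v $ k \<noteq> 0}"

text \<open>The symbol in coordinate \<open>k\<close> is moved to coordinate \<open>p k\<close>.\<close>

definition permute_vec :: "('n \<Rightarrow> 'n) \<Rightarrow> bit ^ 'n \<Rightarrow> bit ^ 'n" where
  "permute_vec p v = (\<chi> k. v $ inv p k)"

definition ep_diff :: "(nat \<Rightarrow> bit ^ 'n) \<Rightarrow> nat \<Rightarrow> nat \<Rightarrow> bit ^ 'n" where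
  "ep_diff e i j = e i + e j"

text \<open>\<^const>\<open>product_lists\<close> varies the last entry fastest, so this lists the binary strings of
  length \<open>j\<close> in lexicographic order.\<close>

definition bit_strings :: "nat \<Rightarrow> bit list list" where
  "bit_strings j = product_lists (replicate j [0, 1])"

definition comb_weight :: "(bit ^ 'n) list \<Rightarrow> bit list \<Rightarrow> nat" where
  "comb_weight us b =
     (if b = replicate (length us) 0 then CARD('n)
      else hamming_weight (\<Sum>i<length us. (b ! i) *s (us ! i)))"

definition weight_relationship :: "(bit ^ 'n) list \<Rightarrow> nat list" where
  "weight_relationship us = map (comb_weight us) (bit_strings (length us))"

text \<open>The tuple length \<open>j\<close> is determined by \<open>g\<close>, which has $2^j$ entries, but is passed
  explicitly.\<close>

definition multiplicity_Z :: "(bit ^ 'n) set \<Rightarrow> nat \<Rightarrow> nat list \<Rightarrow> nat" where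
  "multiplicity_Z C j g =
     card {us. length us = j \<and> set us \<subseteq> C \<and> weight_relationship us = g}"

definition column_count :: "(bit ^ 'n) list \<Rightarrow> bit list \<Rightarrow> nat" where
  "column_count xs s = card {k. map (\<lambda>x. x $ k) xs = s}"

text \<open>A function of \<open>g\<close> alone: the column counts of a tuple \<open>xs\<close> are determined by its weight
  relationship, so on weight relationships the description picks out a unique value. The
  type argument fixes the coordinate set, which does not occur in the type of \<open>g\<close>.\<close>

definition coord_perm_factor :: "'n::finite itself \<Rightarrow> nat list \<Rightarrow> nat" where
  "coord_perm_factor N g =
     (THE h. \<exists>xs :: (bit ^ 'n) list. weight_relationship xs = g \<and>
        h = (\<Prod>s\<in>{s. length s = length xs}. fact (column_count xs s)))"

definition increasing_tuples :: "nat \<Rightarrow> nat \<Rightarrow> nat list set" where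
  "increasing_tuples j t =
     {is. length is = j \<and> sorted_wrt (<) is \<and> set is \<subseteq> {1..<t}}"

definition coord_perms :: "('n::finite \<Rightarrow> 'n) set" where
  "coord_perms = {p. p permutes UNIV}"

definition pretarget_hit_prob ::
    "'w measure \<Rightarrow> ('w \<Rightarrow> 'n::finite \<Rightarrow> 'n) \<Rightarrow> (bit ^ 'n) set \<Rightarrow> (nat \<Rightarrow> bit ^ 'n) \<Rightarrow> nat \<Rightarrow> real"
  where
  "pretarget_hit_prob M \<pi> C e t =
     measure M {\<omega> \<in> space M. \<exists>t'\<in>{1..<t}. permute_vec (\<pi> \<omega>) (ep_diff e t' t) \<in> C}"

end

theory Submission
  imports Defs
begin

text \<open>By inclusion-exclusion over the events that \<open>\<pi>\<close> maps \<open>e i + e t\<close> into \<open>C\<close>, everything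
  reduces to counting the permutations that map a given tuple \<open>xs\<close> into \<open>C\<close>. Sort them by the
  image tuple. A tuple \<open>us\<close> is an image of \<open>xs\<close> iff both have the same number of coordinates with
  column \<open>s\<close>, for every \<open>s\<close>, and then the permutations taking \<open>xs\<close> to \<open>us\<close> form a coset of the
  group that preserves the columns of \<open>xs\<close>, which has \<open>\<Prod>s. J(s)!\<close> elements. The column counts
  and the weight relationship determine each other: the weights are, up to an affine change, the
  Fourier transform of the column counts on $\mathbb{F}_2^j$.\<close>

subsection \<open>Permutations compatible with a colouring\<close>

text \<open>Induction on the colours, with \<open>X\<close> varying: a colour-preserving permutation
  splits uniquely into an arbitrary permutation of one colour class and a colour-preserving
  permutation of the rest. Colours in \<open>S\<close> that never occur contribute
  \<open>fact 0 = 1\<close>.\<close>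

lemma card_colour_preserving_permutations:
  assumes "finite S" "finite X" "A ` X \<subseteq> S"
  shows "card {p. p permutes X \<and> (\<forall>x\<in>X. A (p x) = A x)} = (\<Prod>s\<in>S. fact (card {x\<in>X. A x = s}))"
  using assms
proof (induction S arbitrary: X rule: finite_induct)
  case empty
  then show ?case by simp
next
  case (insert s S)
  define Y where "Y = {x\<in>X. A x = s}"
  define Z where "Z = {x\<in>X. A x \<noteq> s}"
  let ?G = "\<lambda>X. {p. p permutes X \<and> (\<forall>x\<in>X. A (p x) = A x)}"
  have XYZ: "X = Y \<union> Z" "Y \<inter> Z = {}" and fin: "finite Y" "finite Z"
    using insert.prems by (auto simp: Y_def Z_def)
  have "bij_betw (\<lambda>r. (restrict_id r Y, restrict_id r Z)) (?G X) ({p. p permutes Y} \<times> ?G Z)"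
  proof (rule bij_betw_byWitness[where f' = "\<lambda>(p, q). p \<circ> q"])
    show "\<forall>r\<in>?G X. (\<lambda>(p, q). p \<circ> q) (restrict_id r Y, restrict_id r Z) = r"
    proof
      fix r assume r: "r \<in> ?G X"
      then have *: "r x \<in> X" if "x \<in> X" for x
        using that by (simp add: permutes_in_image)
      show "(\<lambda>(p, q). p \<circ> q) (restrict_id r Y, restrict_id r Z) = r"
      proof
        fix x
        show "(\<lambda>(p, q). p \<circ> q) (restrict_id r Y, restrict_id r Z) x = r x"
          using r * [of x] by (auto simp: restrict_id_def Y_def Z_def permutes_not_in)
      qed
    qed
    show "\<forall>pq\<in>{p. p permutes Y} \<times> ?G Z.
        (restrict_id ((\<lambda>(p, q). p \<circ> q) pq) Y, restrict_id ((\<lambda>(p, q). p \<circ> q) pq) Z) = pq"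
    proof
      fix pq assume "pq \<in> {p. p permutes Y} \<times> ?G Z"
      then obtain p q where pq: "pq = (p, q)" and p: "p permutes Y" and q: "q permutes Z"
        by blast
      have "restrict_id (p \<circ> q) Y = p"
      proof
        fix x
        show "restrict_id (p \<circ> q) Y x = p x"
          using p q XYZ(2) by (cases "x \<in> Y") (auto simp: restrict_id_def permutes_not_in disjoint_iff)
      qed
      moreover have "p (q x) = q x" if "x \<in> Z" for x
        using p q XYZ(2) that by (metis disjoint_iff permutes_in_image permutes_not_in)
      then have "restrict_id (p \<circ> q) Z = q"
        using q by (auto simp: restrict_id_def permutes_not_in fun_eq_iff)
      ultimately show "(restrict_id ((\<lambda>(p, q). p \<circ> q) pq) Y,
          restrict_id ((\<lambda>(p, q). p \<circ> q) pq) Z) = pq"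
        by (simp add: pq)
    qed
    show "(\<lambda>r. (restrict_id r Y, restrict_id r Z)) ` ?G X \<subseteq> {p. p permutes Y} \<times> ?G Z"
    proof safe
      fix r assume r: "r permutes X" "\<forall>x\<in>X. A (r x) = A x"
      have "inj r" using r(1) by (rule permutes_inj)
      \<comment> \<open>Both parts are invariant under \<open>r\<close>, and an injective self-map
        of a finite set is onto, so \<open>r\<close> permutes each part.\<close>
      have "r ` Y \<subseteq> Y" "r ` Z \<subseteq> Z"
        using r permutes_in_image[OF r(1)] by (auto simp: Y_def Z_def)
      then have "bij_betw r Y Y" "bij_betw r Z Z"
        using fin \<open>inj r\<close> by (simp_all add: bij_betw_def endo_inj_surj inj_on_subset[OF _ subset_UNIV])
      then show "restrict_id r Y permutes Y" "restrict_id r Z permutes Z"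
        by (simp_all add: permutes_restrict_id)
      fix x assume "x \<in> Z"
      then show "A (restrict_id r Z x) = A x" using r by (simp add: restrict_id_def Z_def)
    qed
    show "(\<lambda>(p, q). p \<circ> q) ` ({p. p permutes Y} \<times> ?G Z) \<subseteq> ?G X"
    proof safe
      fix p q assume p: "p permutes Y" and q: "q permutes Z" "\<forall>x\<in>Z. A (q x) = A x"
      show "p \<circ> q permutes X"
        using p q XYZ(1) by (metis Un_upper1 Un_upper2 permutes_compose permutes_subset)
      fix x assume "x \<in> X"
      have AY: "A y = s" if "y \<in> Y" for y using that by (simp add: Y_def)
      show "A ((p \<circ> q) x) = A x"
      proof (cases "x \<in> Y")
        case True
        then have "q x = x"
          using q(1) XYZ(2) by (metis disjoint_iff permutes_not_in)
        then show ?thesis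
          using True AY permutes_in_image[OF p, of x] by simp
      next
        case False
        then have "x \<in> Z" using \<open>x \<in> X\<close> XYZ by auto
        then have "q x \<notin> Y"
          using permutes_in_image[OF q(1), of x] XYZ(2) by blast
        then show ?thesis
          using permutes_not_in[OF p] q(2) \<open>x \<in> Z\<close> by simp
      qed
    qed
  qed
  then have "card (?G X) = fact (card Y) * card (?G Z)"
    using fin by (simp add: bij_betw_same_card card_cartesian_product card_permutations)
  also have "card (?G Z) = (\<Prod>a\<in>S. fact (card {x\<in>Z. A x = a}))"
    using insert.prems fin by (intro insert.IH) (auto simp: Z_def)
  also have "\<dots> = (\<Prod>a\<in>S. fact (card {x\<in>X. A x = a}))"
    using insert.hyps by (intro prod.cong refl arg_cong[where f = "\<lambda>X. fact (card X)"])
      (auto simp: Z_def)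
  finally show ?case
    using insert.hyps by (simp add: Y_def)
qed

lemma card_colour_matching_permutations:
  fixes A B :: "'a::finite \<Rightarrow> 'b"
  assumes "finite S" "range A \<subseteq> S" and eq: "\<And>s. card {x. A x = s} = card {x. B x = s}"
  shows "card {p. p permutes UNIV \<and> (\<forall>x. B (p x) = A x)} = (\<Prod>s\<in>S. fact (card {x. A x = s}))"
proof -
  \<comment> \<open>Equal class sizes make the multisets of colours agree, which yields one matching
    permutation \<open>p0\<close>. Composing with \<open>p0\<close> then identifies the matching
    permutations with the colour-preserving ones.\<close>
  have "image_mset A (mset_set UNIV) = image_mset B (mset_set UNIV)"
    by (rule multiset_eqI)
      (use eq in \<open>simp add: count_image_mset' sum.If_cases Collect_conj_eq Int_commute eq_commute\<close>)
  then obtain p0 where p0: "p0 permutes UNIV" "\<And>x. A x = B (p0 x)"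
    by (elim image_mset_eq_implies_permutes[OF finite]) auto
  have "bij_betw (\<lambda>q. p0 \<circ> q) {q. q permutes UNIV \<and> (\<forall>x\<in>UNIV. A (q x) = A x)}
      {p. p permutes UNIV \<and> (\<forall>x. B (p x) = A x)}"
    by (rule bij_betw_byWitness[where f' = "\<lambda>p. inv p0 \<circ> p"])
      (use p0 in \<open>auto simp: permutes_inverses fun_eq_iff intro!: permutes_compose permutes_inv\<close>)
  then have "card {p. p permutes UNIV \<and> (\<forall>x. B (p x) = A x)}
      = card {q. q permutes UNIV \<and> (\<forall>x\<in>UNIV. A (q x) = A x)}"
    by (simp add: bij_betw_same_card)
  also have "\<dots> = (\<Prod>s\<in>S. fact (card {x\<in>UNIV. A x = s}))"
    using assms by (intro card_colour_preserving_permutations) auto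
  finally show ?thesis by simp
qed

subsection \<open>Characters of the binary space\<close>

text \<open>Makes the sets of bit strings and of vector tuples of a given length finite, so that
  sums and cardinalities over them do not collapse to the default 0.\<close>

instance bit :: finite
proof
  have "(UNIV :: bit set) = {0, 1}" by auto
  then show "finite (UNIV :: bit set)" by (metis finite.emptyI finite.insertI)
qed

lemma finite_lists_length: "finite {b :: 'a::finite list. length b = n}"
  using finite_lists_length_eq[of "UNIV :: 'a set" n] by simp

lemma set_bit_strings: "set (bit_strings j) = {b. length b = j}"
  by (auto simp: bit_strings_def product_lists_set list_all2_conv_all_nth)

text \<open>For lists of equal length, the character (-1)^(b . s) of the binary space, written as a
  product over positions so that list induction applies.\<close>

definition bit_char :: "bit list \<Rightarrow> bit list \<Rightarrow> int" where
  "bit_char b s = prod_list (map2 (\<lambda>x y. if x * y = 0 then 1 else - 1) b s)"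

text \<open>The sum factors over positions. A position with symbols \<open>x\<close> and
  \<open>y\<close> contributes 1 from the bit 0 and a sign from the bit 1, which is 1 if
  \<open>x = y\<close> and -1 otherwise; the factor is thus 2 or 0.\<close>

lemma bit_char_orthogonal:
  assumes "length s = length s'"
  shows "(\<Sum>b | length b = length s. bit_char b s * bit_char b s')
    = (if s = s' then 2 ^ length s else 0)"
  using assms
proof (induction s s' rule: list_induct2)
  case Nil
  then show ?case by (simp add: bit_char_def)
next
  case (Cons x s y s')
  have split: "{b. length b = length (x # s)}
      = (#) (0::bit) ` {b. length b = length s} \<union> (#) 1 ` {b. length b = length s}"
    by (auto simp: length_Suc_conv image_iff)
  have "(\<Sum>b | length b = length (x # s). bit_char b (x # s) * bit_char b (y # s'))
     = (\<Sum>b | length b = length s. bit_char (0 # b) (x # s) * bit_char (0 # b) (y # s'))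
     + (\<Sum>b | length b = length s. bit_char (1 # b) (x # s) * bit_char (1 # b) (y # s'))"
    unfolding split by (subst sum.union_disjoint) (auto simp: finite_lists_length sum.reindex)
  also have "\<dots> = (if x = y then 2 else 0) * (\<Sum>b | length b = length s. bit_char b s * bit_char b s')"
    by (cases x; cases y) (auto simp: bit_char_def sum_negf)
  finally show ?case by (simp add: Cons.IH)
qed

lemma bit_char_eq:
  "length b = length s \<Longrightarrow>
    bit_char b s = (if (\<Sum>i<length s. b ! i * s ! i) = 0 then 1 else - 1)"
proof (induction b s rule: list_induct2)
  case Nil
  then show ?case by (simp add: bit_char_def)
next
  case (Cons x b y s)
  have "bit_char (x # b) (y # s) = (if x * y = 0 then 1 else - 1) * bit_char b s"
    by (simp add: bit_char_def)
  also have "\<dots> = (if x * y + (\<Sum>i<length s. b ! i * s ! i) = 0 then 1 else - 1)"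
    unfolding Cons.IH by (cases "x * y"; cases "\<Sum>i<length s. b ! i * s ! i") auto
  also have "x * y + (\<Sum>i<length s. b ! i * s ! i) = (\<Sum>i<length (y # s). (x # b) ! i * (y # s) ! i)"
    by (simp add: sum.lessThan_Suc_shift del: sum.lessThan_Suc)
  finally show ?case .
qed

subsection \<open>Weight relationships and column counts\<close>

text \<open>With the tuple as the rows of a matrix, this is column \<open>k\<close>; it serves as
  the colour of coordinate \<open>k\<close>.\<close>

definition symbol_column :: "(bit ^ 'n) list \<Rightarrow> 'n \<Rightarrow> bit list" where
  "symbol_column xs k = map (\<lambda>x. x $ k) xs"

lemma length_symbol_column [simp]: "length (symbol_column xs k) = length xs"
  by (simp add: symbol_column_def)

lemma column_count_eq: "column_count xs s = card {k. symbol_column xs k = s}"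
  by (simp add: column_count_def symbol_column_def)

text \<open>The character at column \<open>k\<close> is 1 or -1 according to whether entry
  \<open>k\<close> of the linear combination vanishes. Grouping coordinates by column, the left side
  is the Fourier transform of the column counts.\<close>

lemma sum_bit_char_symbol_column:
  fixes xs :: "(bit ^ 'n::finite) list"
  assumes "length b = length xs"
  shows "(\<Sum>k\<in>UNIV. bit_char b (symbol_column xs k))
    = int CARD('n) - 2 * int (hamming_weight (\<Sum>i<length xs. (b ! i) *s (xs ! i)))"
proof -
  let ?v = "\<Sum>i<length xs. (b ! i) *s (xs ! i)"
  have "bit_char b (symbol_column xs k) = 1 - 2 * of_bool (?v $ k \<noteq> 0)" for k
    using assms by (simp add: bit_char_eq symbol_column_def)
  then show ?thesis
    by (simp add: hamming_weight_def sum_subtractf flip: sum_distrib_left)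
qed

text \<open>Fourier inversion of the preceding identity. The true Hamming weight appears here: at
  \<open>b = 0\<close> it is 0, whereas \<open>comb_weight\<close> stores N there.\<close>

lemma column_count_Fourier:
  fixes xs :: "(bit ^ 'n::finite) list"
  assumes "length s = length xs"
  shows "2 ^ length xs * int (column_count xs s) = (\<Sum>b | length b = length xs.
    bit_char b s * (int CARD('n) - 2 * int (hamming_weight (\<Sum>i<length xs. (b ! i) *s (xs ! i)))))"
proof -
  have "(\<Sum>b | length b = length xs.
      bit_char b s * (int CARD('n) - 2 * int (hamming_weight (\<Sum>i<length xs. (b ! i) *s (xs ! i)))))
    = (\<Sum>b | length b = length xs. \<Sum>k\<in>UNIV. bit_char b s * bit_char b (symbol_column xs k))"
    by (intro sum.cong) (simp_all add: sum_bit_char_symbol_column flip: sum_distrib_left)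
  also have "\<dots> = (\<Sum>k\<in>UNIV. \<Sum>b | length b = length s. bit_char b s * bit_char b (symbol_column xs k))"
    by (subst sum.swap) (simp add: assms)
  \<comment> \<open>Orthogonality leaves only the coordinates whose column is
    \<open>s\<close>.\<close>
  also have "\<dots> = (\<Sum>k\<in>UNIV. 2 ^ length xs * of_bool (symbol_column xs k = s))"
    using assms by (intro sum.cong refl, subst bit_char_orthogonal) auto
  also have "\<dots> = 2 ^ length xs * int (column_count xs s)"
    by (simp add: column_count_eq flip: sum_distrib_left)
  finally show ?thesis by simp
qed

lemma length_weight_relationship: "length (weight_relationship xs) = 2 ^ length xs"
proof -
  have "length (bit_strings j) = 2 ^ j" for j
    by (induction j) (simp_all add: bit_strings_def)
  then show ?thesis by (simp add: weight_relationship_def)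
qed

lemma column_count_cong:
  fixes xs ys :: "(bit ^ 'n::finite) list"
  assumes "weight_relationship xs = weight_relationship ys"
  shows "length xs = length ys" "column_count xs s = column_count ys s"
proof -
  \<comment> \<open>The weight relationship has \<open>2 ^ j\<close> entries, which determines
    \<open>j\<close>.\<close>
  show len: "length xs = length ys"
    using assms length_weight_relationship[of xs] length_weight_relationship[of ys] by simp
  have hw: "hamming_weight (\<Sum>i<length xs. (b ! i) *s (xs ! i))
      = hamming_weight (\<Sum>i<length ys. (b ! i) *s (ys ! i))" if "length b = length xs" for b
  proof (cases "b = replicate (length xs) 0")
    \<comment> \<open>The entry of the weight relationship at the zero string is N by convention and
      says nothing here, but both combinations are the zero vector.\<close>
    case True
    then show ?thesis using len by simp
  next
    case False
    have "comb_weight xs b = comb_weight ys b"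
      using assms that len by (simp add: weight_relationship_def set_bit_strings)
    then show ?thesis using False len by (simp add: comb_weight_def)
  qed
  show "column_count xs s = column_count ys s"
  proof (cases "length s = length xs")
    case True
    have "2 ^ length xs * int (column_count xs s) = 2 ^ length ys * int (column_count ys s)"
      using column_count_Fourier[OF True] column_count_Fourier[of s ys] True len hw by simp
    then show ?thesis using len by simp
  next
    \<comment> \<open>A string of the wrong length is never a column, so both counts are 0.\<close>
    case False
    then have "{k. symbol_column xs k = s} = {}" "{k. symbol_column ys k = s} = {}"
      using len by (metis (mono_tags, lifting) Collect_empty_eq length_symbol_column)+
    then show ?thesis by (simp add: column_count_eq)
  qed
qed

text \<open>The definite description is well defined: \<open>xs\<close> itself is a witness, and any
  other tuple with the same weights has the same length and column counts.\<close>

lemma coord_perm_factor_weight_relationship: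
  fixes xs :: "(bit ^ 'n::finite) list"
  shows "coord_perm_factor TYPE('n) (weight_relationship xs)
    = (\<Prod>s | length s = length xs. fact (column_count xs s))"
  unfolding coord_perm_factor_def
proof (rule the_equality)
  fix h
  assume "\<exists>ys :: (bit ^ 'n) list. weight_relationship ys = weight_relationship xs \<and>
    h = (\<Prod>s\<in>{s. length s = length ys}. fact (column_count ys s))"
  then obtain ys :: "(bit ^ 'n) list" where ys: "weight_relationship ys = weight_relationship xs"
    and h: "h = (\<Prod>s\<in>{s. length s = length ys}. fact (column_count ys s))" by blast
  show "h = (\<Prod>s | length s = length xs. fact (column_count xs s))"
    unfolding h using column_count_cong[OF ys] by simp
qed blast

subsection \<open>Counting permutations that map a tuple into the code\<close>

text \<open>A coordinate permutation is linear and preserves the Hamming weight. Hence every image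
  of \<open>xs\<close> inside \<open>C\<close> is among the tuples counted by
  \<open>multiplicity_Z\<close>.\<close>

lemma weight_relationship_permute:
  fixes xs :: "(bit ^ 'n::finite) list"
  assumes p: "p permutes UNIV"
  shows "weight_relationship (map (permute_vec p) xs) = weight_relationship xs"
proof -
  have hw: "hamming_weight (permute_vec p v) = hamming_weight v" for v :: "bit ^ 'n"
  proof -
    have "bij_betw p {k. v $ k \<noteq> 0} {k. permute_vec p v $ k \<noteq> 0}"
      by (rule bij_betw_byWitness[where f' = "inv p"])
        (use p in \<open>auto simp: permute_vec_def permutes_inverses\<close>)
    then show ?thesis by (simp add: hamming_weight_def bij_betw_same_card)
  qed
  have "(\<Sum>i<length xs. (b ! i) *s (map (permute_vec p) xs ! i))
      = permute_vec p (\<Sum>i<length xs. (b ! i) *s (xs ! i))" for b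
    by (simp add: vec_eq_iff permute_vec_def)
  then have "comb_weight (map (permute_vec p) xs) b = comb_weight xs b" for b
    by (simp add: comb_weight_def hw)
  then show ?thesis by (simp add: weight_relationship_def)
qed

text \<open>Restates the action on vectors as a matching of colourings; substituting
  \<open>p k\<close> for \<open>k\<close> removes the inverse.\<close>

lemma map_permute_vec_eq_iff:
  fixes xs us :: "(bit ^ 'n::finite) list"
  assumes p: "p permutes UNIV" and len: "length us = length xs"
  shows "map (permute_vec p) xs = us \<longleftrightarrow> (\<forall>k. symbol_column us (p k) = symbol_column xs k)"
proof -
  have "map (permute_vec p) xs = us \<longleftrightarrow> (\<forall>i<length xs. \<forall>k. xs ! i $ inv p k = us ! i $ k)"
    using len by (auto simp: list_eq_iff_nth_eq vec_eq_iff permute_vec_def)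
  also have "\<dots> \<longleftrightarrow> (\<forall>i<length xs. \<forall>k. xs ! i $ k = us ! i $ p k)"
    using p by (metis permutes_inverses)
  also have "\<dots> \<longleftrightarrow> (\<forall>k. symbol_column us (p k) = symbol_column xs k)"
    using len by (auto simp: symbol_column_def list_eq_iff_nth_eq)
  finally show ?thesis .
qed

lemma card_permutations_into_code:
  fixes xs :: "(bit ^ 'n::finite) list"
  shows "card {p \<in> coord_perms. \<forall>x\<in>set xs. permute_vec p x \<in> C}
    = multiplicity_Z C (length xs) (weight_relationship xs)
        * coord_perm_factor TYPE('n) (weight_relationship xs)"
proof -
  let ?U = "{us. length us = length xs \<and> set us \<subseteq> C \<and> weight_relationship us = weight_relationship xs}"
  let ?P = "{p \<in> coord_perms. \<forall>x\<in>set xs. permute_vec p x \<in> C}"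
  \<comment> \<open>The fibre size does not depend on \<open>us\<close>: equal weights force equal
    column counts, so every \<open>us\<close> in \<open>?U\<close> is reached, and by equally many
    permutations. Membership in \<open>C\<close> is automatic since the entries of \<open>us\<close>
    lie in \<open>C\<close>.\<close>
  have fibre: "card {p \<in> ?P. map (permute_vec p) xs = us}
      = coord_perm_factor TYPE('n) (weight_relationship xs)" if us: "us \<in> ?U" for us
  proof -
    have "{p \<in> ?P. map (permute_vec p) xs = us}
        = {p. p permutes UNIV \<and> (\<forall>k. symbol_column us (p k) = symbol_column xs k)}"
      using us map_permute_vec_eq_iff[of _ us xs] by (fastforce simp: coord_perms_def)
    also have "card \<dots> = (\<Prod>s | length s = length xs. fact (card {k. symbol_column xs k = s}))"
      using us column_count_cong(2)[of us xs]
      by (intro card_colour_matching_permutations) (auto simp: finite_lists_length simp flip: column_count_eq)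
    finally show ?thesis
      by (simp add: coord_perm_factor_weight_relationship column_count_eq)
  qed
  have fin: "finite ?U"
    by (rule finite_subset[OF _ finite_lists_length[of "length xs"]]) auto
  \<comment> \<open>Partition the permutations by the image tuple.\<close>
  have "card ?P = (\<Sum>us\<in>?U. card {p \<in> ?P. map (permute_vec p) xs = us})"
    unfolding card_eq_sum
    by (rule sum.group[symmetric]) (use fin in \<open>auto simp: coord_perms_def weight_relationship_permute\<close>)
  also have "\<dots> = card ?U * coord_perm_factor TYPE('n) (weight_relationship xs)"
    using fibre by simp
  finally show ?thesis by (simp add: multiplicity_Z_def)
qed

subsection \<open>Inclusion-exclusion\<close>

lemma bij_betw_increasing_tuples:
  "bij_betw set (increasing_tuples j t) {B. B \<subseteq> {1..<t} \<and> card B = j}"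
proof (rule bij_betw_byWitness[where f' = sorted_list_of_set])
  show "\<forall>is\<in>increasing_tuples j t. sorted_list_of_set (set is) = is"
    by (auto simp: increasing_tuples_def sorted_list_of_set.idem_if_sorted_distinct strict_sorted_iff)
  show "\<forall>B\<in>{B. B \<subseteq> {1..<t} \<and> card B = j}. set (sorted_list_of_set B) = B"
    by (auto simp: finite_subset[OF _ finite_atLeastLessThan])
  show "set ` increasing_tuples j t \<subseteq> {B. B \<subseteq> {1..<t} \<and> card B = j}"
    by (auto simp: increasing_tuples_def strict_sorted_iff distinct_card)
  show "sorted_list_of_set ` {B. B \<subseteq> {1..<t} \<and> card B = j} \<subseteq> increasing_tuples j t"
  proof (rule image_subsetI)
    fix B assume B: "B \<in> {B. B \<subseteq> {1..<t} \<and> card B = j}"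
    \<comment> \<open>\<open>sorted_list_of_set\<close> recovers a set only if it is finite.\<close>
    then have "finite B" using finite_subset[of B "{1..<t}"] by simp
    then show "sorted_list_of_set B \<in> increasing_tuples j t"
      using B by (simp add: increasing_tuples_def)
  qed
qed

text \<open>Inclusion-exclusion over the nonempty index sets, grouped by size, with each set listed
  in increasing order.\<close>

lemma card_UN_increasing_tuples:
  fixes G :: "nat \<Rightarrow> 'a::finite set"
  shows "real (card (\<Union>i\<in>{1..<t}. G i))
    = (\<Sum>j = 1..t - 1. (-1) ^ (j - 1) * (\<Sum>is\<in>increasing_tuples j t. real (card (\<Inter>i\<in>set is. G i))))"
proof -
  let ?F = "\<lambda>B. (-1) ^ (card B + 1) * real (card (\<Inter>i\<in>B. G i))"
  let ?S = "{B. B \<subseteq> {1..<t} \<and> B \<noteq> {}}"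
  have "real (card (\<Union>i\<in>{1..<t}. G i)) = (\<Sum>B\<in>?S. ?F B)"
    using Incl_Excl_UN[of "\<lambda>S. real (card S)" "{1..<t}" G] by (simp add: card_Un_disjnt)
  also have "\<dots> = (\<Sum>j = 1..t - 1. \<Sum>B | B \<in> ?S \<and> card B = j. ?F B)"
  proof (rule sum.group[symmetric])
    show "card ` ?S \<subseteq> {1..t - 1}"
    proof (rule image_subsetI)
      fix B assume "B \<in> ?S"
      then have B: "B \<subseteq> {1..<t}" "B \<noteq> {}" by auto
      then show "card B \<in> {1..t - 1}"
        using card_mono[of "{1..<t}" B] card_gt_0_iff[of B] finite_subset[OF B(1)] by auto
    qed
  qed auto
  also have "\<dots> = (\<Sum>j = 1..t - 1. (-1) ^ (j - 1) *
      (\<Sum>is\<in>increasing_tuples j t. real (card (\<Inter>i\<in>set is. G i))))"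
  proof (rule sum.cong[OF refl])
    fix j assume j: "j \<in> {1..t - 1}"
    then have S: "{B \<in> ?S. card B = j} = {B. B \<subseteq> {1..<t} \<and> card B = j}"
      by auto
    \<comment> \<open>The exponents differ by 2; this uses \<open>j \<ge> 1\<close>, as subtraction
      on naturals truncates.\<close>
    have sgn: "(-1::real) ^ (j + 1) = (-1) ^ (j - 1)"
      using j by (cases j) auto
    have "(\<Sum>B | B \<in> ?S \<and> card B = j. ?F B) = (\<Sum>is\<in>increasing_tuples j t. ?F (set is))"
      unfolding S by (rule sum.reindex_bij_betw[OF bij_betw_increasing_tuples, symmetric])
    also have "\<dots> = (\<Sum>is\<in>increasing_tuples j t. (-1) ^ (j - 1) * real (card (\<Inter>i\<in>set is. G i)))"
    proof (rule sum.cong[OF refl])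
      fix "is" assume "is \<in> increasing_tuples j t"
      then have "card (set is) = j"
        using bij_betw_apply[OF bij_betw_increasing_tuples] by blast
      then show "?F (set is) = (-1) ^ (j - 1) * real (card (\<Inter>i\<in>set is. G i))"
        using sgn by simp
    qed
    finally show "(\<Sum>B | B \<in> ?S \<and> card B = j. ?F B)
        = (-1) ^ (j - 1) * (\<Sum>is\<in>increasing_tuples j t. real (card (\<Inter>i\<in>set is. G i)))"
      by (simp add: sum_distrib_left)
  qed
  finally show ?thesis .
qed

lemma measure_uniform_permutation:
  fixes \<pi> :: "'w \<Rightarrow> 'n::finite \<Rightarrow> 'n"
  assumes rv: "\<pi> \<in> M \<rightarrow>\<^sub>M count_space coord_perms"
    and uniform: "distr M (count_space coord_perms) \<pi> = uniform_count_measure coord_perms"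
  shows "measure M {\<omega> \<in> space M. P (\<pi> \<omega>)} = real (card {p \<in> coord_perms. P p}) / fact CARD('n)"
proof -
  \<comment> \<open>Writing the event as a preimage lets the uniform law of \<open>\<pi>\<close>
    turn its probability into a count.\<close>
  have "{\<omega> \<in> space M. P (\<pi> \<omega>)} = \<pi> -` {p \<in> coord_perms. P p} \<inter> space M"
    using measurable_space[OF rv] by auto
  then have "measure M {\<omega> \<in> space M. P (\<pi> \<omega>)}
      = measure (distr M (count_space coord_perms) \<pi>) {p \<in> coord_perms. P p}"
    using rv by (subst measure_distr) auto
  also have "\<dots> = real (card {p \<in> coord_perms. P p}) / real (card (coord_perms :: ('n \<Rightarrow> 'n) set))"
    unfolding uniform by (subst measure_uniform_count_measure) auto
  also have "card (coord_perms :: ('n \<Rightarrow> 'n) set) = fact CARD('n)"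
    by (simp add: coord_perms_def card_permutations)
  finally show ?thesis by simp
qed

theorem theorem6:
  fixes C :: "(bit ^ 'n::finite) set"
    and e :: "nat \<Rightarrow> bit ^ 'n"
    and T t :: nat
    and M :: "'w measure"
    and \<pi> :: "'w \<Rightarrow> 'n \<Rightarrow> 'n"
  assumes code: "vec.subspace C"
    and distinct_patterns: "inj_on e {1..T}"
    and prob: "prob_space M"
    and rv: "\<pi> \<in> M \<rightarrow>\<^sub>M count_space coord_perms"
    and uniform: "distr M (count_space coord_perms) \<pi> = uniform_count_measure coord_perms"
    and t: "1 \<le> t" "t \<le> T"
  shows "pretarget_hit_prob M \<pi> C e t =
    (\<Sum>j = 1..t - 1. (-1) ^ (j - 1) *
      (\<Sum>is\<in>increasing_tuples j t.
        let g = weight_relationship (map (\<lambda>i. ep_diff e i t) is)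
        in 1 / fact (CARD('n)) * real (multiplicity_Z C j g)
             * real (coord_perm_factor TYPE('n) g)))"
proof -
  let ?d = "\<lambda>i. ep_diff e i t"
  let ?G = "\<lambda>i. {p \<in> coord_perms. permute_vec p (?d i) \<in> C}"
  let ?g = "\<lambda>is. weight_relationship (map ?d is)"
  have count: "real (card (\<Inter>i\<in>set is. ?G i))
      = real (multiplicity_Z C j (?g is)) * real (coord_perm_factor TYPE('n) (?g is))"
    if "is \<in> increasing_tuples j t" "1 \<le> j" for j "is"
  proof -
    \<comment> \<open>Nonemptiness matters: an empty intersection would be the set of all functions,
      not only the permutations.\<close>
    have "length is = j" "is \<noteq> []"
      using that by (auto simp: increasing_tuples_def)
    moreover from this have "(\<Inter>i\<in>set is. ?G i)
        = {p \<in> coord_perms. \<forall>x\<in>set (map ?d is). permute_vec p x \<in> C}"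
      by (cases "is") auto
    ultimately show ?thesis
      using card_permutations_into_code[of "map ?d is" C] by (simp flip: of_nat_mult)
  qed
  have "pretarget_hit_prob M \<pi> C e t
      = real (card {p \<in> coord_perms. \<exists>t'\<in>{1..<t}. permute_vec p (?d t') \<in> C}) / fact CARD('n)"
    unfolding pretarget_hit_prob_def using rv uniform by (rule measure_uniform_permutation)
  also have "{p \<in> coord_perms. \<exists>t'\<in>{1..<t}. permute_vec p (?d t') \<in> C} = (\<Union>i\<in>{1..<t}. ?G i)"
    by auto
  also have "real (card \<dots>) / fact CARD('n) = (\<Sum>j = 1..t - 1. (-1) ^ (j - 1) *
      (\<Sum>is\<in>increasing_tuples j t. real (card (\<Inter>i\<in>set is. ?G i)))) / fact CARD('n)"
    unfolding card_UN_increasing_tuples ..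
  \<comment> \<open>Every \<open>j\<close> in the range is at least 1, so \<open>count\<close>
    applies to each term, and the factor 1/N! is distributed over the sums.\<close>
  also have "\<dots> = (\<Sum>j = 1..t - 1. (-1) ^ (j - 1) * (\<Sum>is\<in>increasing_tuples j t.
      1 / fact CARD('n) * real (multiplicity_Z C j (?g is)) * real (coord_perm_factor TYPE('n) (?g is))))"
    by (simp add: count sum_divide_distrib sum_distrib_left mult_ac)
  finally show ?thesis by (simp only: Let_def)
qed

end
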